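(* Let $n\ge 0$ be an integer and $\sigma\ge n+1$ a real number. Then every function $f\in S_n^\sigma$ is starlike univalent in $E$, i.e. $f$ is univalent in $E$ and maps $E$ onto a domain starlike with respect to the origin (equivalently, $\mathrm{Re}\,\frac{zf'(z)}{f(z)}>0$ for $z\in E$).
   Context: Let $E=\{z\in\mathbb{C}:|z|<1\}$ and let $A$ be the class of analytic functions on $E$ of the form $f(z)=z+\sum_{k\ge2}a_kz^k$. For an integer $n\ge0$ and a real number $\sigma$ with $\sigma-(n-1)>0$, the operator $L_n^\sigma:A\to A$ is defined by $$L_n^\sigma f(z)=z+\sum_{k=2}^\infty\left\{\prod_{j=0}^{n-1}\frac{\sigma+k-1-j}{\sigma-j}\right\}a_kz^k$$ (the empty product is $1$, so $L_0^\sigma f=f$). For an integer $n\ge0$ and real $\sigma\ge n+1$, a function $f\in A$ belongs to the class $S_n^\sigma$ if and only if $$\mathrm{Re}\,\frac{L_{n+1}^\sigma f(z)}{L_n^\sigma f(z)}>\frac{\sigma-(n+1)}{\sigma-n},\qquad z\in E.$$ Quotients of functions vanishing at $z=0$ are understood at $z=0$ as their limits. *)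

theory Defs
  imports "HOL-Complex_Analysis.Complex_Analysis"
begin

abbreviation unit_disc :: "complex set" where
  "unit_disc \<equiv> ball 0 1"

definition taylor_coeff :: "(complex \<Rightarrow> complex) \<Rightarrow> nat \<Rightarrow> complex" where
  "taylor_coeff f k = (deriv ^^ k) f 0 / fact k"

text \<open>Functions on the disc are total functions of which only the values on the disc
  matter.  Series that start at index 2 are written with the index shifted to \<open>k + 2\<close>.\<close>

definition class_A :: "(complex \<Rightarrow> complex) set" where
  "class_A = {f. f analytic_on unit_disc \<and>
     (\<forall>z\<in>unit_disc. (\<lambda>k. taylor_coeff f (k + 2) * z ^ (k + 2)) sums (f z - z))}"

text \<open>Meant for \<open>\<sigma> - (n - 1) > 0\<close>, where all denominators are positive.\<close>

definition L_op :: "nat \<Rightarrow> real \<Rightarrow> (complex \<Rightarrow> complex) \<Rightarrow> complex \<Rightarrow> complex" where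
  "L_op n \<sigma> f z = z + (\<Sum>k. complex_of_real
       (\<Prod>j<n. (\<sigma> + real (k + 2) - 1 - real j) / (\<sigma> - real j))
       * taylor_coeff f (k + 2) * z ^ (k + 2))"

definition quot0 :: "(complex \<Rightarrow> complex) \<Rightarrow> (complex \<Rightarrow> complex) \<Rightarrow> complex \<Rightarrow> complex" where
  "quot0 g h z = (if z = 0 then Lim (at 0) (\<lambda>w. g w / h w) else g z / h z)"

text \<open>At a point \<open>z \<noteq> 0\<close> where the denominator vanishes the quotient is \<open>0\<close>.  For
  \<open>\<sigma> \<ge> n + 1\<close> the bound on the right is nonnegative, so the strict inequality
  fails at such a point: membership forces the denominator to be nonzero off the origin.\<close>

definition class_S :: "nat \<Rightarrow> real \<Rightarrow> (complex \<Rightarrow> complex) set" where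
  "class_S n \<sigma> = {f \<in> class_A. \<forall>z\<in>unit_disc.
     Re (quot0 (L_op (n + 1) \<sigma> f) (L_op n \<sigma> f) z)
       > (\<sigma> - (real n + 1)) / (\<sigma> - real n)}"

text \<open>The library's \<open>starlike\<close> leaves the centre existentially quantified; here it is
  the origin.\<close>

definition starlike_domain :: "complex set \<Rightarrow> bool" where
  "starlike_domain D \<longleftrightarrow> open D \<and> connected D \<and> 0 \<in> D \<and> (\<forall>w\<in>D. closed_segment 0 w \<subseteq> D)"

definition starlike_univalent :: "(complex \<Rightarrow> complex) \<Rightarrow> bool" where
  "starlike_univalent f \<longleftrightarrow> inj_on f unit_disc \<and> starlike_domain (f ` unit_disc)"

lemma class_A_iff:
  "f \<in> class_A \<longleftrightarrow> f holomorphic_on unit_disc \<and> f 0 = 0 \<and> deriv f 0 = 1"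
proof (cases "f holomorphic_on unit_disc")
  case False
  then show ?thesis by (simp add: class_A_def analytic_on_open)
next
  case True
  have full: "(\<lambda>k. taylor_coeff f (k + 2) * z ^ (k + 2)) sums (f z - f 0 - deriv f 0 * z)"
    if "z \<in> unit_disc" for z
  proof -
    have "(\<lambda>k. taylor_coeff f k * z ^ k) sums f z"
      using holomorphic_power_series[OF True that] by (simp add: taylor_coeff_def)
    from sums_split_initial_segment[OF this, of 2] show ?thesis
      by (simp add: taylor_coeff_def numeral_2_eq_2 algebra_simps)
  qed
  have "(\<forall>z\<in>unit_disc. f z - f 0 - deriv f 0 * z = f z - z) \<longleftrightarrow> f 0 = 0 \<and> deriv f 0 = 1"
    (is "?L \<longleftrightarrow> ?R")
  proof
    assume L: ?L
    from L[rule_format, of 0] have "f 0 = 0" by simp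
    moreover from L[rule_format, of "1/2"] have "f 0 + deriv f 0 / 2 = 1 / 2"
      by (simp add: norm_divide algebra_simps)
    ultimately show ?R by simp
  qed simp
  moreover have "(\<lambda>k. taylor_coeff f (k + 2) * z ^ (k + 2)) sums (f z - z)
      \<longleftrightarrow> f z - f 0 - deriv f 0 * z = f z - z" if "z \<in> unit_disc" for z
    using full[OF that] sums_unique2 by metis
  ultimately show ?thesis
    using True by (simp add: class_A_def analytic_on_open)
qed

lemma L_op_0:
  assumes "f \<in> class_A" "z \<in> unit_disc"
  shows "L_op 0 \<sigma> f z = f z"
  using assms by (auto simp: L_op_def class_A_def dest!: bspec sums_unique[symmetric])

end

theory Submission
  imports Defs
begin

text \<open>Comparing coefficients, with \<open>L\<^sub>n = L_op n \<sigma> f\<close>,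
  \<open>(\<sigma> - n) L\<^sub>n\<^sub>+\<^sub>1 = z L\<^sub>n' + (\<sigma> - n - 1) L\<^sub>n\<close>.
  Dividing by \<open>L\<^sub>n\<close> turns the defining inequality of the class \<open>S\<close> into the analytic
  condition for starlikeness, \<open>Re (z L\<^sub>n' / L\<^sub>n) > 0\<close>.  So the claim is that starlikeness of
  \<open>L\<^sub>n\<close> passes down to \<open>L\<^sub>0 = f\<close>, one index at a time.

  One step down says that if \<open>F = (z G' + c G) / (1 + c)\<close> is starlike and \<open>c > 0\<close>, then so is
  \<open>G\<close>: the Bernardi integral transform preserves starlikeness (\<open>Bernardi_starlike\<close>).
  With \<open>p = z G' / G\<close> the logarithmic derivative of \<open>F\<close> satisfies
  \<open>z F' / F = p + z p' / (p + c)\<close>.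
  At a point \<open>z\<^sub>0\<close> of smallest modulus at which \<open>Re p\<close> is not positive, \<open>p\<close> is purely
  imaginary, so \<open>- z\<^sub>0 / (p + c)\<close> points into the smaller disc, where \<open>Re p > 0\<close>.  Hence
  \<open>Re p\<close> cannot decrease in that direction, which says \<open>Re (z\<^sub>0 p' / (p + c)) \<le> 0\<close> and
  contradicts \<open>Re (z F' / F) > 0\<close>.

  That the analytic condition gives the geometric one is seen in logarithmic coordinates:
  \<open>\<phi> s = log f (exp s)\<close> on the left half-plane has derivative \<open>z f' / f\<close> at \<open>z = exp s\<close>, of
  positive real part, so it is injective; as it commutes with translation by \<open>2 \<pi> \<i>\<close>, \<open>f\<close>
  is injective.  The same inequality says that the modulus of the preimage shrinks when a
  point of the image moves towards the origin, so the image is starlike.\<close>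

section \<open>Real derivatives along lines\<close>

lemma has_real_derivative_Re_along_line:
  assumes "(f has_field_derivative D) (at (a + complex_of_real t * d))"
  shows "((\<lambda>s. Re (f (a + complex_of_real s * d))) has_real_derivative Re (d * D)) (at t)"
proof -
  have "((\<lambda>s. a + complex_of_real s * d) has_vector_derivative d) (at t)"
    by (auto intro!: derivative_eq_intros has_vector_derivative_of_real)
  from field_vector_diff_chain_at[OF this assms]
  have "((\<lambda>s. f (a + complex_of_real s * d)) has_vector_derivative d * D) (at t)"
    by (simp add: o_def)
  then show ?thesis
    by (rule has_field_derivative_Re)
qed

lemma has_real_derivative_norm_power2_along_line:
  assumes "(f has_field_derivative D) (at (a + complex_of_real t * d))"
  shows "((\<lambda>s. (cmod (f (a + complex_of_real s * d)))\<^sup>2) has_real_derivative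
           2 * Re (d * D * cnj (f (a + complex_of_real t * d)))) (at t)"
proof -
  have "((\<lambda>z. - \<i> * f z) has_field_derivative - \<i> * D) (at (a + complex_of_real t * d))"
    by (rule DERIV_cmult[OF assms])
  from has_real_derivative_Re_along_line[OF this]
  have "((\<lambda>s. Im (f (a + complex_of_real s * d))) has_real_derivative Im (d * D)) (at t)"
    by (simp add: add.commute)
  from DERIV_add[OF DERIV_power[OF has_real_derivative_Re_along_line[OF assms], of 2]
      DERIV_power[OF this, of 2]]
  show ?thesis
    unfolding cmod_power2 by (simp add: algebra_simps)
qed

section \<open>Logarithmic derivatives in the class A\<close>

lemma class_A_D:
  assumes "f \<in> class_A"
  shows "f holomorphic_on unit_disc" "f 0 = 0" "deriv f 0 = 1"
    and "z \<in> unit_disc \<Longrightarrow> (f has_field_derivative deriv f z) (at z)"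
  using assms by (auto simp: class_A_iff intro!: holomorphic_derivI[of f unit_disc])

lemma class_A_quotient_tendsto_1:
  assumes "f \<in> class_A"
  shows "((\<lambda>z. f z / z) \<longlongrightarrow> 1) (at 0)"
  using class_A_D[OF assms] class_A_D(4)[OF assms, of 0] by (simp add: DERIV_def)

text \<open>This limit both starts the minimal-modulus argument, by making the real part positive near the
  origin, and gives the value of the quotient at the origin.\<close>

lemma class_A_log_derivative_tendsto_1:
  assumes "f \<in> class_A"
  shows "((\<lambda>z. z * deriv f z / f z) \<longlongrightarrow> 1) (at 0)"
proof -
  have "deriv f holomorphic_on unit_disc"
    using class_A_D(1)[OF assms] by (rule holomorphic_deriv) simp
  then have "isCont (deriv f) 0"
    by (auto simp: continuous_on_eq_continuous_at dest!: holomorphic_on_imp_continuous_on)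
  then have "(deriv f \<longlongrightarrow> 1) (at 0)"
    using class_A_D(3)[OF assms] by (simp add: isCont_def)
  from tendsto_divide[OF this class_A_quotient_tendsto_1[OF assms]]
  have "((\<lambda>z. deriv f z / (f z / z)) \<longlongrightarrow> 1) (at 0)" by simp
  then show ?thesis by (simp add: mult.commute)
qed

section \<open>The recursion for the operators\<close>

text \<open>Multiplies the coefficient at index \<open>k\<close> by \<open>(k + s - 1) / s\<close>, which is the factor that leads
  from \<open>L_op n \<sigma>\<close> to \<open>L_op (Suc n) \<sigma>\<close> when \<open>s = \<sigma> - n\<close>.\<close>

definition multiplier_op :: "real \<Rightarrow> (complex \<Rightarrow> complex) \<Rightarrow> complex \<Rightarrow> complex" where
  "multiplier_op s F z = (z * deriv F z + complex_of_real (s - 1) * F z) / complex_of_real s"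

lemma multiplier_op_class_A:
  assumes F: "F \<in> class_A" and s: "s > 0"
  shows "multiplier_op s F \<in> class_A"
    and "taylor_coeff (multiplier_op s F) k = complex_of_real ((real k + s - 1) / s) * taylor_coeff F k"
proof -
  note D = class_A_D[OF F]
  have dF: "deriv F holomorphic_on unit_disc" by (rule holomorphic_deriv[OF D(1)]) simp
  have hol: "multiplier_op s F holomorphic_on unit_disc"
    unfolding multiplier_op_def using s by (intro holomorphic_intros dF D(1)) auto
  define P where "P = fps_expansion F 0"
  have FP: "F has_fps_expansion P"
    unfolding P_def by (rule has_fps_expansion_fps_expansion[OF _ _ D(1)]) auto
  have "(\<lambda>z. complex_of_real (1 / s) * (z * deriv F z + complex_of_real (s - 1) * F z)) has_fps_expansion
      fps_const (complex_of_real (1 / s)) * (fps_X * fps_deriv P + fps_const (complex_of_real (s - 1)) * P)"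
    by (intro fps_expansion_intros FP)
  then have ex: "multiplier_op s F has_fps_expansion
      fps_const (complex_of_real (1 / s)) * (fps_X * fps_deriv P + fps_const (complex_of_real (s - 1)) * P)"
    (is "_ has_fps_expansion ?Q")
    by (simp add: multiplier_op_def[abs_def])
  have coeff: "taylor_coeff (multiplier_op s F) k = complex_of_real ((real k + s - 1) / s) * taylor_coeff F k" for k
  proof -
    have "taylor_coeff (multiplier_op s F) k = fps_nth ?Q k"
      by (simp only: taylor_coeff_def fps_nth_fps_expansion[OF ex])
    also have "\<dots> = complex_of_real ((real k + s - 1) / s) * fps_nth P k"
      using s by (cases k) (auto simp: field_simps)
    finally show ?thesis by (simp only: taylor_coeff_def fps_nth_fps_expansion[OF FP])
  qed
  show "taylor_coeff (multiplier_op s F) k = complex_of_real ((real k + s - 1) / s) * taylor_coeff F k"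
    by (rule coeff)
  have "multiplier_op s F 0 = 0" using D(2) by (simp add: multiplier_op_def)
  moreover have "deriv (multiplier_op s F) 0 = 1"
    using coeff[of 1] s D(3) by (simp add: taylor_coeff_def)
  ultimately show "multiplier_op s F \<in> class_A" using hol by (simp add: class_A_iff)
qed

lemma class_A_cong:
  assumes "F \<in> class_A" and eq: "\<And>z. z \<in> unit_disc \<Longrightarrow> G z = F z"
  shows "G \<in> class_A" and "taylor_coeff G k = taylor_coeff F k"
proof -
  have "\<forall>\<^sub>F z in nhds 0. G z = F z"
    by (rule eventually_mono[OF eventually_nhds_in_open[of unit_disc 0]]) (auto simp: eq)
  then have hd: "(deriv ^^ k) G 0 = (deriv ^^ k) F 0" for k
    by (rule higher_deriv_cong_ev) simp
  then show "taylor_coeff G k = taylor_coeff F k" by (simp add: taylor_coeff_def)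
  have "G holomorphic_on unit_disc"
    using class_A_D(1)[OF assms(1)] by (rule holomorphic_transform) (simp add: eq)
  then show "G \<in> class_A"
    using class_A_D[OF assms(1)] hd[of 0] hd[of 1] by (simp add: class_A_iff)
qed

definition L_coeff :: "nat \<Rightarrow> real \<Rightarrow> nat \<Rightarrow> real" where
  "L_coeff n \<sigma> k = (\<Prod>j<n. (\<sigma> + real k - 1 - real j) / (\<sigma> - real j))"

lemma L_coeff_Suc:
  "L_coeff (Suc n) \<sigma> k = (real k + (\<sigma> - real n) - 1) / (\<sigma> - real n) * L_coeff n \<sigma> k"
  by (simp add: L_coeff_def algebra_simps)

text \<open>\<open>L_op\<close> is given by a series, which carries information only once it is known to converge.  The
  right-hand side here is holomorphic, so its Taylor series converges on the disc, and
  its coefficients are those of \<open>L_op (Suc n) \<sigma> f\<close>.\<close>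

lemma L_op_Suc_if_L_coeff:
  assumes L: "L_op n \<sigma> f \<in> class_A"
    and coeff: "\<And>k. taylor_coeff (L_op n \<sigma> f) (k + 2) = L_coeff n \<sigma> (k + 2) * taylor_coeff f (k + 2)"
    and s: "\<sigma> > real n" and z: "z \<in> unit_disc"
  shows "L_op (Suc n) \<sigma> f z = multiplier_op (\<sigma> - real n) (L_op n \<sigma> f) z"
proof -
  let ?M = "multiplier_op (\<sigma> - real n) (L_op n \<sigma> f)"
  have M: "?M \<in> class_A" by (rule multiplier_op_class_A[OF L]) (use s in simp)
  have "taylor_coeff ?M (k + 2) = L_coeff (Suc n) \<sigma> (k + 2) * taylor_coeff f (k + 2)" for k
    using multiplier_op_class_A(2)[OF L, of "\<sigma> - real n" "k + 2"] s unfolding coeff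
    by (simp add: L_coeff_Suc)
  then have "(\<lambda>k. L_coeff (Suc n) \<sigma> (k + 2) * taylor_coeff f (k + 2) * z ^ (k + 2)) sums (?M z - z)"
    using M z by (simp add: class_A_def)
  then have "z + (\<Sum>k. L_coeff (Suc n) \<sigma> (k + 2) * taylor_coeff f (k + 2) * z ^ (k + 2)) = ?M z"
    by (simp only: sums_unique[symmetric]) simp
  then show ?thesis by (simp only: L_op_def flip: L_coeff_def)
qed

text \<open>Convergence for index \<open>Suc n\<close> comes from the recursion, and the recursion from membership and
  coefficients for index \<open>n\<close>, so both are proved in one induction.\<close>

lemma L_op_class_A:
  assumes f: "f \<in> class_A" and s: "\<sigma> > real n - 1"
  shows "L_op n \<sigma> f \<in> class_A"
    and "taylor_coeff (L_op n \<sigma> f) (k + 2) = L_coeff n \<sigma> (k + 2) * taylor_coeff f (k + 2)"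
proof -
  have "L_op n \<sigma> f \<in> class_A \<and>
    (\<forall>k. taylor_coeff (L_op n \<sigma> f) (k + 2) = L_coeff n \<sigma> (k + 2) * taylor_coeff f (k + 2))"
    using s
  proof (induction n)
    case 0
    have "L_op 0 \<sigma> f z = f z" if "z \<in> unit_disc" for z
      by (rule L_op_0[OF f that])
    from class_A_cong[OF f this] show ?case by (simp add: L_coeff_def)
  next
    case (Suc n)
    then have L: "L_op n \<sigma> f \<in> class_A"
      and coeff: "\<And>k. taylor_coeff (L_op n \<sigma> f) (k + 2) = L_coeff n \<sigma> (k + 2) * taylor_coeff f (k + 2)"
      and s: "\<sigma> > real n" by auto
    have M: "multiplier_op (\<sigma> - real n) (L_op n \<sigma> f) \<in> class_A"
      by (rule multiplier_op_class_A[OF L]) (use s in simp)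
    note eq = L_op_Suc_if_L_coeff[OF L coeff s]
    have "taylor_coeff (L_op (Suc n) \<sigma> f) (k + 2) = L_coeff (Suc n) \<sigma> (k + 2) * taylor_coeff f (k + 2)" for k
      using multiplier_op_class_A(2)[OF L, of "\<sigma> - real n" "k + 2"] s
        class_A_cong(2)[OF M eq, of "k + 2"]
      unfolding coeff by (simp add: L_coeff_Suc)
    with class_A_cong(1)[OF M eq] show ?case by blast
  qed
  then show "L_op n \<sigma> f \<in> class_A"
    and "taylor_coeff (L_op n \<sigma> f) (k + 2) = L_coeff n \<sigma> (k + 2) * taylor_coeff f (k + 2)"
    by blast+
qed

lemma L_op_Suc:
  assumes f: "f \<in> class_A" and s: "\<sigma> > real n" and z: "z \<in> unit_disc"
  shows "L_op (Suc n) \<sigma> f z =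
      (z * deriv (L_op n \<sigma> f) z + complex_of_real (\<sigma> - real n - 1) * L_op n \<sigma> f z)
        / complex_of_real (\<sigma> - real n)"
  using L_op_Suc_if_L_coeff[OF L_op_class_A[OF f] s z] s by (simp add: multiplier_op_def)

section \<open>The Bernardi transform preserves starlikeness\<close>

text \<open>That \<open>G\<close> has no zero off the origin is part of the claim.  The minimal-modulus argument is
  therefore run on \<open>q = Re (z G' cnj G)\<close>, which is continuous on the whole disc, has
  the sign of \<open>Re (z G' / G)\<close> where \<open>G\<close> is nonzero, and vanishes at the zeros of \<open>G\<close>.\<close>

lemma Bernardi_starlike:
  fixes c :: real and F G :: "complex \<Rightarrow> complex"
  assumes c: "c > 0" and G: "G \<in> class_A"
    and F: "\<And>z. z \<in> unit_disc \<Longrightarrow> F z = (z * deriv G z + complex_of_real c * G z) / complex_of_real (1 + c)"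
    and F_star: "\<And>z. z \<in> unit_disc \<Longrightarrow> z \<noteq> 0 \<Longrightarrow> Re (z * deriv F z / F z) > 0"
    and z: "z \<in> unit_disc" "z \<noteq> 0"
  shows "Re (z * deriv G z / G z) > 0"
proof (rule ccontr)
  assume contra: "\<not> Re (z * deriv G z / G z) > 0"
  define q where "q w = Re (w * deriv G w * cnj (G w))" for w :: complex
  have q_eq: "q w = Re (w * deriv G w / G w) * (cmod (G w))\<^sup>2" for w
    by (cases "G w = 0") (auto simp: q_def complex_div_cnj[of _ "G w"] simp flip: of_real_power)
  have G'_hol: "deriv G holomorphic_on unit_disc"
    using class_A_D(1)[OF G] by (rule holomorphic_deriv) simp
  have q_cont: "continuous_on unit_disc q"
    unfolding q_def
    by (intro continuous_intros holomorphic_on_imp_continuous_on G'_hol class_A_D(1)[OF G])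
  have "\<forall>\<^sub>F w in at 0. Re (w * deriv G w / G w) > 0"
    by (rule order_tendstoD(1)[OF tendsto_Re[OF class_A_log_derivative_tendsto_1[OF G]]]) simp
  then obtain e where e: "e > 0"
    and near0: "\<And>w. w \<noteq> 0 \<Longrightarrow> cmod w < e \<Longrightarrow> Re (w * deriv G w / G w) > 0"
    by (auto simp: eventually_at)
  \<comment> \<open>Removing the disc of radius \<open>e\<close> keeps the origin, where \<open>q\<close> vanishes, out of \<open>B\<close>.\<close>
  define B where "B = {w \<in> cball 0 (cmod z) - ball 0 e. q w \<le> 0}"
  have "e \<le> cmod z"
    by (rule ccontr) (use contra near0[of z] z in auto)
  then have "z \<in> B"
    using contra z mult_nonpos_nonneg[of "Re (z * deriv G z / G z)" "(cmod (G z))\<^sup>2"]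
    by (auto simp: B_def q_eq not_less)
  have "continuous_on (cball 0 (cmod z) - ball 0 e) q"
    using z by (intro continuous_on_subset[OF q_cont]) auto
  then have "closed ((cball 0 (cmod z) - ball 0 e) \<inter> q -` {..0})"
    by (intro continuous_closed_preimage) auto
  moreover have "B = (cball 0 (cmod z) - ball 0 e) \<inter> q -` {..0}" by (auto simp: B_def)
  ultimately have "closed B" by simp
  moreover have "bounded B" by (rule bounded_subset[of "cball 0 (cmod z)"]) (auto simp: B_def)
  ultimately have "compact B" by (simp add: compact_eq_bounded_closed)
  with \<open>z \<in> B\<close> obtain z0 where z0B: "z0 \<in> B" and z0_min: "\<And>w. w \<in> B \<Longrightarrow> cmod z0 \<le> cmod w"
    using continuous_attains_inf[of B cmod] by (auto intro: continuous_intros)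
  have z0: "z0 \<in> unit_disc" "z0 \<noteq> 0" "q z0 \<le> 0" "cmod z0 \<le> cmod z"
    using z0B z e by (auto simp: B_def)
  have inside: "Re (w * deriv G w / G w) > 0" if "w \<noteq> 0" "cmod w < cmod z0" for w
  proof (rule ccontr)
    assume n: "\<not> Re (w * deriv G w / G w) > 0"
    with near0[of w] that(1) have "e \<le> cmod w" by force
    with n that z0(4) have "w \<in> B"
      by (auto simp: B_def q_eq mult_nonpos_nonneg)
    with z0_min that(2) show False by force
  qed
  have q_inside: "q w > 0" if "w \<noteq> 0" "cmod w < cmod z0" for w
  proof -
    have "G w \<noteq> 0" using inside[OF that] by auto
    then show ?thesis using inside[OF that] by (simp add: q_eq)
  qed
  have ray: "of_real t * z0 \<in> unit_disc" if "0 \<le> t" "t \<le> 1" for t :: real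
    using that z0(1) mult_left_le_one_le[of "cmod z0" t] by (simp add: norm_mult)
  \<comment> \<open>On the ray through \<open>z0\<close> the derivative of the square of the modulus of \<open>G\<close> is \<open>2 q / t\<close>, so the
      modulus grows from \<open>0\<close> and \<open>G\<close> cannot vanish at \<open>z0\<close>.\<close>
  have "(cmod (G (0 + of_real 0 * z0)))\<^sup>2 < (cmod (G (0 + of_real 1 * z0)))\<^sup>2"
  proof (rule DERIV_pos_imp_increasing_open[where f = "\<lambda>s. (cmod (G (0 + complex_of_real s * z0)))\<^sup>2"])
    fix t :: real assume t: "0 < t" "t < 1"
    let ?w = "of_real t * z0"
    have "((\<lambda>s. (cmod (G (0 + complex_of_real s * z0)))\<^sup>2) has_real_derivative
           2 * Re (z0 * deriv G ?w * cnj (G (0 + ?w)))) (at t)"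
      using ray[of t] t
      by (intro has_real_derivative_norm_power2_along_line) (auto intro: class_A_D(4)[OF G])
    moreover have "t * Re (z0 * deriv G ?w * cnj (G (0 + ?w))) = q ?w"
      by (simp add: q_def algebra_simps)
    moreover have "q ?w > 0" using t z0(2) by (intro q_inside) (auto simp: norm_mult)
    ultimately show "\<exists>y. ((\<lambda>s. (cmod (G (0 + complex_of_real s * z0)))\<^sup>2)
        has_real_derivative y) (at t) \<and> 0 < y"
      using t by (metis mult_pos_pos zero_less_mult_pos zero_less_numeral)
  next
    show "continuous_on {0..1} (\<lambda>s. (cmod (G (0 + complex_of_real s * z0)))\<^sup>2)"
      by (intro continuous_intros continuous_on_compose2[OF holomorphic_on_imp_continuous_on[OF class_A_D(1)[OF G]]])
         (use ray in auto)
  qed simp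
  then have Gz0: "G z0 \<noteq> 0" using class_A_D(2)[OF G] by auto
  have "q z0 \<ge> 0"
  proof (rule tendsto_lowerbound)
    have "isCont q z0" using q_cont z0(1) by (simp add: continuous_on_eq_continuous_at)
    then have "((\<lambda>t. q (complex_of_real t * z0)) \<longlongrightarrow> q (complex_of_real 1 * z0)) (at_left 1)"
      by (intro isCont_tendsto_compose[of _ q] tendsto_intros) simp_all
    then show "((\<lambda>t. q (complex_of_real t * z0)) \<longlongrightarrow> q z0) (at_left 1)" by simp
    have "\<forall>\<^sub>F t in at_left 1. t \<in> {0<..<1::real}"
      by (rule eventually_at_left_real) simp
    then show "\<forall>\<^sub>F t in at_left 1. 0 \<le> q (complex_of_real t * z0)"
      by eventually_elim (use z0(2) in \<open>auto intro!: less_imp_le[OF q_inside] simp: norm_mult\<close>)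
  qed simp
  with z0(3) have "q z0 = 0" by simp
  define p where "p w = w * deriv G w / G w" for w :: complex
  have Rep0: "Re (p z0) = 0"
    using \<open>q z0 = 0\<close> Gz0 by (simp add: q_eq p_def)
  have "(deriv G has_field_derivative deriv (deriv G) z0) (at z0)"
    using G'_hol z0(1) by (auto intro!: holomorphic_derivI)
  then obtain p' where p': "(p has_field_derivative p') (at z0)"
    unfolding p_def using DERIV_divide[OF DERIV_mult[OF DERIV_ident] class_A_D(4)[OF G z0(1)] Gz0]
    by blast
  have pc: "p z0 + c \<noteq> 0" and Repc: "Re (p z0 + c) > 0"
    using Rep0 c by (auto simp: complex_eq_iff)
  have F_log: "z0 * deriv F z0 / F z0 = p z0 + z0 * p' / (p z0 + c)"
  proof -
    define m where "m = complex_of_real (1 + c)"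
    have m: "m \<noteq> 0" unfolding m_def of_real_eq_0_iff using c by simp
    have "\<forall>\<^sub>F w in nhds z0. G w \<noteq> 0"
    proof (rule tendsto_imp_eventually_ne[OF _ Gz0])
      show "(G \<longlongrightarrow> G z0) (nhds z0)"
        using DERIV_isCont[OF class_A_D(4)[OF G z0(1)]] by (simp add: continuous_at tendsto_at_iff_tendsto_nhds)
    qed
    then have "\<forall>\<^sub>F w in nhds z0. F w = (p w + c) * G w / m"
      using eventually_nhds_in_open[OF open_ball z0(1)]
      by eventually_elim (simp add: F p_def m_def algebra_simps)
    moreover have "((\<lambda>w. (p w + c) * G w / m) has_field_derivative
        (p' * G z0 + (p z0 + c) * deriv G z0) / m) (at z0)"
      using m by (auto intro!: derivative_eq_intros p' class_A_D(4)[OF G z0(1)] simp: field_simps)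
    ultimately have "(F has_field_derivative (p' * G z0 + (p z0 + c) * deriv G z0) / m) (at z0)"
      by (simp add: DERIV_cong_ev)
    then have F': "deriv F z0 = (p' * G z0 + (p z0 + c) * deriv G z0) / m"
      by (rule DERIV_imp_deriv)
    have pz0: "z0 * deriv G z0 = p z0 * G z0" using Gz0 by (simp add: p_def)
    have F0: "F z0 = (p z0 + c) * G z0 / m"
      using F[OF z0(1)] by (simp add: pz0 m_def algebra_simps)
    have "z0 * deriv F z0 / F z0 =
        z0 * (p' * G z0 + (p z0 + c) * deriv G z0) / ((p z0 + c) * G z0)"
      unfolding F' F0 using m by simp
    also have "z0 * (p' * G z0 + (p z0 + c) * deriv G z0) = z0 * p' * G z0 + (p z0 + c) * (z0 * deriv G z0)"
      by (simp add: algebra_simps)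
    also have "\<dots> / ((p z0 + c) * G z0) =
        z0 * p' * G z0 / ((p z0 + c) * G z0) + (p z0 + c) * (p z0 * G z0) / ((p z0 + c) * G z0)"
      unfolding pz0 by (rule add_divide_distrib)
    also have "\<dots> = p z0 + z0 * p' / (p z0 + c)"
      using Gz0 pc by simp
    finally show ?thesis .
  qed
  \<comment> \<open>This direction turns the derivative of \<open>Re p\<close> into \<open>- Re (z0 p' / (p z0 + c))\<close>, and it points
      into the disc of radius \<open>|z0|\<close> because \<open>p z0 + c\<close> has real part \<open>c > 0\<close>.\<close>
  define d where "d = - z0 / (p z0 + c)"
  have "Re (d * p') \<ge> 0"
  proof (rule ccontr)
    assume "\<not> Re (d * p') \<ge> 0"
    moreover have "((\<lambda>s. Re (p (z0 + complex_of_real s * d))) has_real_derivative Re (d * p')) (at 0)"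
      by (rule has_real_derivative_Re_along_line[where f = p]) (simp add: p')
    ultimately have "\<exists>\<delta>>0. \<forall>h>0. 0 + h \<in> UNIV \<longrightarrow> h < \<delta> \<longrightarrow>
        Re (p (z0 + complex_of_real 0 * d)) > Re (p (z0 + complex_of_real (0 + h) * d))"
      by (intro has_real_derivative_neg_dec_right[where f = "\<lambda>s. Re (p (z0 + complex_of_real s * d))"]) auto
    then obtain \<delta>1 where d1: "\<delta>1 > 0"
      and less: "\<And>h. h > 0 \<Longrightarrow> h < \<delta>1 \<Longrightarrow> Re (p (z0 + complex_of_real h * d)) < 0"
      using Rep0 by auto
    have "((\<lambda>s. (cmod (z0 + complex_of_real s * d))\<^sup>2) has_real_derivative
        2 * Re (d * 1 * cnj (z0 + complex_of_real 0 * d))) (at 0)"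
      by (rule has_real_derivative_norm_power2_along_line[of "\<lambda>w. w"]) simp
    moreover have "Re (d * cnj z0) < 0"
    proof -
      have "d * cnj z0 = - (of_real ((cmod z0)\<^sup>2) / (p z0 + c))"
        by (simp add: d_def complex_norm_square flip: of_real_power)
      also have "Re \<dots> = - ((cmod z0)\<^sup>2 * Re (p z0 + c) / (cmod (p z0 + c))\<^sup>2)"
        by (simp add: Re_divide cmod_power2)
      also have "\<dots> < 0" using Repc z0(2) pc by simp
      finally show ?thesis .
    qed
    ultimately have "\<exists>\<delta>>0. \<forall>h>0. 0 + h \<in> UNIV \<longrightarrow> h < \<delta> \<longrightarrow>
        (cmod (z0 + complex_of_real 0 * d))\<^sup>2 > (cmod (z0 + complex_of_real (0 + h) * d))\<^sup>2"
      by (intro has_real_derivative_neg_dec_right[where f = "\<lambda>s. (cmod (z0 + complex_of_real s * d))\<^sup>2"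
            and l = "2 * Re (d * 1 * cnj (z0 + complex_of_real 0 * d))"]) auto
    then obtain \<delta>2 where d2: "\<delta>2 > 0"
      and inw: "\<And>h. h > 0 \<Longrightarrow> h < \<delta>2 \<Longrightarrow> (cmod (z0 + complex_of_real h * d))\<^sup>2 < (cmod z0)\<^sup>2"
      by auto
    define h where "h = min \<delta>1 \<delta>2 / 2"
    have h: "h > 0" "h < \<delta>1" "h < \<delta>2" using d1 d2 by (auto simp: h_def min_def)
    let ?w = "z0 + complex_of_real h * d"
    have "cmod ?w < cmod z0" using inw[OF h(1,3)] by (rule power2_less_imp_less) simp
    moreover have "?w \<noteq> 0" using less[OF h(1,2)] by (auto simp: p_def)
    ultimately have "Re (p ?w) > 0" unfolding p_def by (intro inside)
    with less[OF h(1,2)] show False by simp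
  qed
  then have "Re (z0 * p' / (p z0 + c)) \<le> 0" by (simp add: d_def)
  with F_star[OF z0(1,2)] Rep0 show False by (simp add: F_log)
qed

section \<open>From the class S to the starlikeness condition\<close>

lemma class_S_imp_starlike_condition:
  assumes s: "\<sigma> \<ge> real n + 1" and f: "f \<in> class_S n \<sigma>" and z: "z \<in> unit_disc" "z \<noteq> 0"
  shows "Re (z * deriv (L_op n \<sigma> f) z / L_op n \<sigma> f z) > 0"
proof -
  define c where "c = \<sigma> - real n"
  have c: "c > 0" using s by (simp add: c_def)
  have fA: "f \<in> class_A" using f by (simp add: class_S_def)
  let ?L = "L_op n \<sigma> f"
  have "Re (quot0 (L_op (n + 1) \<sigma> f) ?L z) > (\<sigma> - (real n + 1)) / (\<sigma> - real n)"
    using f z(1) by (simp only: class_S_def mem_Collect_eq)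
  then have gt: "Re (L_op (Suc n) \<sigma> f z / ?L z) > (c - 1) / c"
    using z(2) by (simp add: quot0_def c_def diff_diff_eq add.commute)
  moreover have "(c - 1) / c \<ge> 0" using s by (simp add: c_def)
  ultimately have L: "?L z \<noteq> 0" by auto
  have "L_op (Suc n) \<sigma> f z / ?L z = (z * deriv ?L z / ?L z + of_real (c - 1)) / of_real c"
    using L_op_Suc[OF fA _ z(1), of n \<sigma>] s L c
    by (simp add: c_def divide_simps)
  with gt have "(c - 1) / c < (Re (z * deriv ?L z / ?L z) + (c - 1)) / c"
    by (simp only: Re_divide_of_real plus_complex.sel complex.sel Re_complex_of_real)
  then show ?thesis using c by (simp add: divide_less_cancel)
qed

text \<open>The step from \<open>Suc n\<close> to \<open>n\<close> uses the Bernardi transform with \<open>c = \<sigma> - n - 1\<close>, and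
  \<open>\<sigma> \<ge> Suc n + 1\<close> makes this at least \<open>1\<close>.\<close>

lemma starlike_condition_descends:
  assumes s: "\<sigma> \<ge> real n + 1" and fA: "f \<in> class_A"
    and top: "\<And>z. z \<in> unit_disc \<Longrightarrow> z \<noteq> 0 \<Longrightarrow> Re (z * deriv (L_op n \<sigma> f) z / L_op n \<sigma> f z) > 0"
    and z: "z \<in> unit_disc" "z \<noteq> 0"
  shows "Re (z * deriv f z / f z) > 0"
  using s top z
proof (induction n arbitrary: z)
  case 0
  have "deriv (L_op 0 \<sigma> f) z = deriv f z"
    using 0(3) L_op_0[OF fA]
    by (intro deriv_cong_ev refl eventually_mono[OF eventually_nhds_in_open[of unit_disc z]]) auto
  with 0(2)[OF 0(3,4)] show ?case by (simp only: L_op_0[OF fA 0(3)])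
next
  case (Suc n)
  have "Re (w * deriv (L_op n \<sigma> f) w / L_op n \<sigma> f w) > 0" if w: "w \<in> unit_disc" "w \<noteq> 0" for w
  proof (rule Bernardi_starlike[of "\<sigma> - real n - 1" _ "L_op (Suc n) \<sigma> f"])
    show "L_op n \<sigma> f \<in> class_A" using L_op_class_A(1)[OF fA] Suc.prems(1) by simp
    show "L_op (Suc n) \<sigma> f v = (v * deriv (L_op n \<sigma> f) v + complex_of_real (\<sigma> - real n - 1) * L_op n \<sigma> f v)
        / complex_of_real (1 + (\<sigma> - real n - 1))" if "v \<in> unit_disc" for v
      using L_op_Suc[OF fA _ that, of n \<sigma>] Suc.prems(1) by simp
  qed (use Suc.prems w in auto)
  then show ?case using Suc by auto
qed

section \<open>The starlikeness condition and the geometry of the image\<close>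

text \<open>The Noshiro--Warschawski criterion: the real part of
  \<open>f / (b - a)\<close> strictly increases along the segment from \<open>a\<close> to \<open>b\<close>.\<close>

lemma inj_on_if_Re_deriv_pos:
  assumes "convex S" and f: "\<And>z. z \<in> S \<Longrightarrow> (f has_field_derivative f' z) (at z)"
    and pos: "\<And>z. z \<in> S \<Longrightarrow> Re (f' z) > 0"
  shows "inj_on f S"
proof (rule inj_onI, rule ccontr)
  fix a b assume ab: "a \<in> S" "b \<in> S" "f a = f b" "a \<noteq> b"
  have seg: "a + complex_of_real t * (b - a) \<in> S" if "0 \<le> t" "t \<le> 1" for t
    using convexD_alt[OF assms(1) ab(1,2) that] by (simp add: algebra_simps scaleR_conv_of_real)
  have "Re (f (a + complex_of_real 0 * (b - a)) / (b - a)) < Re (f (a + complex_of_real 1 * (b - a)) / (b - a))"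
  proof (rule DERIV_pos_imp_increasing[where f = "\<lambda>s. Re (f (a + complex_of_real s * (b - a)) / (b - a))"])
    fix t :: real assume t: "0 \<le> t" "t \<le> 1"
    let ?w = "a + complex_of_real t * (b - a)"
    have "((\<lambda>s. Re (f (a + complex_of_real s * (b - a)) / (b - a))) has_real_derivative
        Re ((b - a) * (f' ?w / (b - a)))) (at t)"
      by (rule has_real_derivative_Re_along_line[where f = "\<lambda>w. f w / (b - a)"])
         (rule DERIV_cdivide[OF f[OF seg[OF t]]])
    with pos[OF seg[OF t]] ab(4)
    show "\<exists>y. ((\<lambda>s. Re (f (a + complex_of_real s * (b - a)) / (b - a))) has_real_derivative y) (at t) \<and> 0 < y"
      by auto
  qed simp
  with ab(3) show False by simp
qed

text \<open>The half-plane is convex, so injectivity there follows from a derivative of positive real part.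
  The logarithm is built as \<open>s + k (exp s)\<close> with \<open>k\<close> a logarithm of \<open>f z / z\<close> on the whole disc,
  because this form shows how it behaves under translation by \<open>2 \<pi> \<i>\<close>.\<close>

lemma univalent_if_starlike_condition:
  assumes f: "f \<in> class_A"
    and star: "\<And>z. z \<in> unit_disc \<Longrightarrow> z \<noteq> 0 \<Longrightarrow> Re (z * deriv f z / f z) > 0"
  shows "inj_on f unit_disc"
proof -
  have f_nz: "f z \<noteq> 0" if "z \<in> unit_disc" "z \<noteq> 0" for z
    using star[OF that] by auto
  define h where "h z = (if z = 0 then 1 else f z / z)" for z
  have h_hol: "h holomorphic_on unit_disc"
    by (rule pole_theorem_open_0[where g = f and a = 0])
       (use class_A_D[OF f] in \<open>auto simp: h_def\<close>)
  have h_nz: "h z \<noteq> 0" if "z \<in> unit_disc" for z using f_nz[OF that] by (auto simp: h_def)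
  obtain k where k_hol: "k holomorphic_on unit_disc" and k: "\<And>z. z \<in> unit_disc \<Longrightarrow> h z = exp (k z)"
    using contractible_imp_holomorphic_log[OF h_hol _ h_nz] convex_imp_contractible[OF convex_ball]
    by blast
  define H where "H = {s. Re s < 0}"
  define \<phi> where "\<phi> s = s + k (exp s)" for s
  have exp_disc: "exp s \<in> unit_disc" if "s \<in> H" for s using that by (simp add: H_def)
  have exp_\<phi>: "exp (\<phi> s) = f (exp s)" if "s \<in> H" for s
    using k[OF exp_disc[OF that]] by (simp add: \<phi>_def exp_add h_def divide_simps split: if_splits)
  have \<phi>_deriv: "(\<phi> has_field_derivative exp s * deriv f (exp s) / f (exp s)) (at s)" if s: "s \<in> H" for s
  proof -
    have "(\<phi> has_field_derivative 1 + deriv k (exp s) * exp s) (at s)"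
      unfolding \<phi>_def
      by (rule DERIV_add[OF DERIV_ident DERIV_chain2[OF _ DERIV_exp]])
         (use k_hol exp_disc[OF s] in \<open>auto intro!: holomorphic_derivI\<close>)
    then have D: "(\<phi> has_field_derivative deriv \<phi> s) (at s)"
      using DERIV_imp_deriv by metis
    have "((\<lambda>s. exp (\<phi> s)) has_field_derivative exp (\<phi> s) * deriv \<phi> s) (at s)"
      by (rule DERIV_chain2[OF DERIV_exp D])
    moreover have "((\<lambda>s. f (exp s)) has_field_derivative deriv f (exp s) * exp s) (at s)"
      by (rule DERIV_chain2[OF class_A_D(4)[OF f exp_disc[OF s]] DERIV_exp])
    moreover have "\<forall>\<^sub>F s in nhds s. exp (\<phi> s) = f (exp s)"
      using eventually_nhds_in_open[of H s] s
      by (rule_tac eventually_mono[of "\<lambda>s. s \<in> H"]) (auto simp: exp_\<phi> H_def open_halfspace_Re_lt)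
    ultimately have "exp (\<phi> s) * deriv \<phi> s = deriv f (exp s) * exp s"
      using DERIV_unique DERIV_cong_ev[OF refl _ refl] by metis
    then have "deriv \<phi> s = exp s * deriv f (exp s) / f (exp s)"
      using f_nz[OF exp_disc[OF s]] by (simp add: exp_\<phi>[OF s] divide_simps mult.commute)
    with D show ?thesis by simp
  qed
  have \<phi>_inj: "inj_on \<phi> H"
    by (rule inj_on_if_Re_deriv_pos[OF _ \<phi>_deriv])
       (auto simp: H_def convex_halfspace_Re_lt exp_disc[unfolded H_def] intro!: star)
  have inj_nz: "a = b" if ab: "a \<in> unit_disc" "b \<in> unit_disc" "a \<noteq> 0" "b \<noteq> 0" "f a = f b" for a b
  proof -
    have H: "Ln a \<in> H" "Ln b \<in> H" using ab by (auto simp: H_def)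
    have "exp (\<phi> (Ln a)) = exp (\<phi> (Ln b))" using ab H by (simp add: exp_\<phi>)
    then obtain m :: int where m: "\<phi> (Ln a) = \<phi> (Ln b) + of_int (2 * m) * pi * \<i>"
      by (auto simp: exp_eq)
    let ?s = "Ln b + of_int (2 * m) * pi * \<i>"
    have e: "exp ?s = exp (Ln b)" using exp_eq by blast
    have "\<phi> (Ln a) = \<phi> ?s" using m unfolding \<phi>_def e by simp
    moreover have "?s \<in> H" using H(2) by (simp add: H_def)
    ultimately have "Ln a = ?s" using \<phi>_inj H(1) by (auto dest: inj_onD)
    then have "exp (Ln a) = exp (Ln b)" using e by simp
    then show ?thesis using ab by simp
  qed
  show ?thesis
  proof (rule inj_onI)
    fix a b assume ab: "a \<in> unit_disc" "b \<in> unit_disc" "f a = f b"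
    show "a = b"
      using inj_nz[OF ab(1,2) _ _ ab(3)] f_nz[OF ab(1)] f_nz[OF ab(2)] ab(3) class_A_D(2)[OF f]
      by metis
  qed
qed

text \<open>Let \<open>g\<close> be the inverse of \<open>f\<close>.  At \<open>s w = f z\<close> the derivative of \<open>|g (s w)|\<^sup>2\<close> in \<open>s\<close> is
  \<open>2 |z|\<^sup>2 Re (f z / (z f' z)) / s > 0\<close>.  So a point moving from \<open>f z0\<close> to the origin
  never leaves the compact set \<open>f ` cball 0 |z0|\<close>.\<close>

lemma starlike_univalent_if_starlike_condition:
  assumes f: "f \<in> class_A"
    and star: "\<And>z. z \<in> unit_disc \<Longrightarrow> z \<noteq> 0 \<Longrightarrow> Re (z * deriv f z / f z) > 0"
  shows "starlike_univalent f"
proof -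
  have inj: "inj_on f unit_disc" by (rule univalent_if_starlike_condition[OF f star])
  note hol = class_A_D(1)[OF f]
  obtain g where g_hol: "g holomorphic_on f ` unit_disc"
    and g': "\<And>z. z \<in> unit_disc \<Longrightarrow> deriv f z * deriv g (f z) = 1"
    and g: "\<And>z. z \<in> unit_disc \<Longrightarrow> g (f z) = z"
    using holomorphic_has_inverse[OF hol open_ball inj] by metis
  have op: "open (f ` unit_disc)" by (rule open_mapping_thm3[OF hol open_ball inj])
  have conn: "connected (f ` unit_disc)"
    by (intro connected_continuous_image holomorphic_on_imp_continuous_on hol) simp
  have zero: "0 \<in> f ` unit_disc" using class_A_D(2)[OF f] by (force intro: image_eqI[of _ _ 0])
  have ray: "complex_of_real s0 * f z0 \<in> f ` cball 0 (cmod z0)"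
    if z0: "z0 \<in> unit_disc" and s0: "0 \<le> s0" "s0 \<le> 1" for z0 s0
  proof (rule ccontr)
    let ?K = "f ` cball 0 (cmod z0)" and ?w = "f z0"
    assume s0K: "complex_of_real s0 * ?w \<notin> ?K"
    have sub: "cball 0 (cmod z0) \<subseteq> unit_disc" using z0 by auto
    have "0 \<in> ?K" using class_A_D(2)[OF f] by (force intro: image_eqI[of _ _ 0])
    then have s0_pos: "s0 > 0" and w: "?w \<noteq> 0" using s0K s0 by (auto simp: le_less)
    have "compact ?K"
      by (intro compact_continuous_image compact_cball holomorphic_on_imp_continuous_on
          holomorphic_on_subset[OF hol sub])
    then have "closed ({s0..1} \<inter> (\<lambda>s. complex_of_real s * ?w) -` ?K)"
      by (intro continuous_closed_preimage continuous_intros compact_imp_closed) auto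
    moreover define T where "T = {s0..1} \<inter> (\<lambda>s. complex_of_real s * ?w) -` ?K"
    ultimately have "compact T" by (auto intro: compact_Int_closed simp: compact_eq_bounded_closed bounded_Int)
    moreover have "1 \<in> T" using s0 by (auto simp: T_def)
    ultimately obtain s where s: "s \<in> T" and s_min: "\<And>t. t \<in> T \<Longrightarrow> s \<le> t"
      using compact_attains_inf[of T] by auto
    \<comment> \<open>Below the smallest parameter \<open>s\<close> the preimage can still be followed, and its modulus decreases,
      so a smaller parameter belongs to \<open>T\<close> as well.\<close>
    obtain z where z: "cmod z \<le> cmod z0" "of_real s * ?w = f z" using s by (auto simp: T_def)
    have zd: "z \<in> unit_disc" using z sub by auto
    have s_gt: "s > s0" using s s0K by (auto simp: T_def le_less)
    have fz: "f z \<noteq> 0" using s_gt s0_pos w z(2) by (metis mult_eq_0_iff of_real_eq_0_iff less_trans less_irrefl)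
    then have z_nz: "z \<noteq> 0" using class_A_D(2)[OF f] by auto
    have f'_nz: "deriv f z \<noteq> 0" using g'[OF zd] by auto
    have "(g has_field_derivative deriv g (f z)) (at (f z))"
      using g_hol op zd by (auto intro!: holomorphic_derivI)
    moreover have s_at: "0 + complex_of_real s * ?w = f z" using z(2) by simp
    ultimately have gD: "(g has_field_derivative deriv g (f z)) (at (0 + complex_of_real s * ?w))"
      by simp
    note N = has_real_derivative_norm_power2_along_line[OF gD]
    have "s * Re (?w * deriv g (f z) * cnj z) > 0"
    proof -
      have "of_real s * (?w * deriv g (f z) * cnj z) = f z * deriv g (f z) * cnj z"
        by (simp flip: z(2))
      also have "\<dots> = f z * (1 / deriv f z) * cnj z" using g'[OF zd] f'_nz by (simp add: field_simps)
      also have "\<dots> = of_real ((cmod z)\<^sup>2) * inverse (z * deriv f z / f z)"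
        using f'_nz fz z_nz by (simp add: complex_norm_square field_simps flip: of_real_power)
      finally have "of_real s * (?w * deriv g (f z) * cnj z)
          = of_real ((cmod z)\<^sup>2) * inverse (z * deriv f z / f z)" .
      moreover have "Re (complex_of_real a * x) = a * Re x" for a x by simp
      ultimately have "s * Re (?w * deriv g (f z) * cnj z)
          = (cmod z)\<^sup>2 * Re (inverse (z * deriv f z / f z))"
        by metis
      moreover have "Re (inverse (z * deriv f z / f z)) > 0"
        using star[OF zd z_nz] by (simp only: inverse_complex.sel) (auto intro!: divide_pos_pos add_pos_nonneg)
      ultimately show ?thesis using z_nz by simp
    qed
    then have "2 * Re (?w * deriv g (f z) * cnj (g (0 + complex_of_real s * ?w))) > 0"
      using s_gt s0_pos unfolding s_at g[OF zd] by (auto simp: zero_less_mult_iff)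
    from has_real_derivative_pos_inc_left[OF N this] obtain \<delta> where d: "\<delta> > 0"
      and dec: "\<And>h. h > 0 \<Longrightarrow> h < \<delta> \<Longrightarrow>
        (cmod (g (complex_of_real (s - h) * ?w)))\<^sup>2 < (cmod z)\<^sup>2"
      unfolding s_at g[OF zd] by auto
    have "isCont (\<lambda>t. complex_of_real t * ?w) s" by (intro continuous_intros)
    then have "\<forall>\<^sub>F t in at s. complex_of_real t * ?w \<in> f ` unit_disc"
      using op zd z(2) by (auto simp: isCont_def dest!: topological_tendstoD)
    then obtain \<eta> where eta: "\<eta> > 0"
      and img: "\<And>t. t \<noteq> s \<Longrightarrow> \<bar>t - s\<bar> < \<eta> \<Longrightarrow> complex_of_real t * ?w \<in> f ` unit_disc"
      by (auto simp: eventually_at dist_real_def)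
    define h where "h = Min {\<delta>, \<eta>, s - s0} / 2"
    have h: "h > 0" "h < \<delta>" "h < \<eta>" "h < s - s0" using d eta s_gt by (auto simp: h_def min_def)
    obtain v where v: "v \<in> unit_disc" "complex_of_real (s - h) * ?w = f v"
      using img[of "s - h"] h by auto
    have "cmod v < cmod z" using dec[OF h(1,2)] unfolding v(2) g[OF v(1)] by (rule power2_less_imp_less) simp
    then have "s - h \<in> T" using h s z(1) v(2) by (auto simp: T_def)
    with s_min[of "s - h"] h(1) show False by simp
  qed
  have "closed_segment 0 w \<subseteq> f ` unit_disc" if "w \<in> f ` unit_disc" for w
  proof
    fix v assume "v \<in> closed_segment 0 w"
    then obtain u where u: "0 \<le> u" "u \<le> 1" "v = of_real u * w"
      by (auto simp: closed_segment_def scaleR_conv_of_real)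
    from that obtain z where z: "z \<in> unit_disc" "w = f z" by auto
    from ray[OF z(1) u(1,2)] obtain x where "cmod x \<le> cmod z" "v = f x" using u z by auto
    then show "v \<in> f ` unit_disc" using z(1) by auto
  qed
  with inj op conn zero show ?thesis
    by (auto simp: starlike_univalent_def starlike_domain_def)
qed

theorem corollary1:
  fixes n :: nat and \<sigma> :: real and f :: "complex \<Rightarrow> complex"
  assumes "\<sigma> \<ge> real n + 1"
    and "f \<in> class_S n \<sigma>"
  shows "starlike_univalent f \<and>
         (\<forall>z\<in>unit_disc. Re (quot0 (\<lambda>w. w * deriv f w) f z) > 0)"
proof -
  have f: "f \<in> class_A" using assms(2) by (simp add: class_S_def)
  have star: "Re (z * deriv f z / f z) > 0" if "z \<in> unit_disc" "z \<noteq> 0" for z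
    using starlike_condition_descends[OF assms(1) f class_S_imp_starlike_condition[OF assms] that] .
  have "Lim (at 0) (\<lambda>w. w * deriv f w / f w) = 1"
    by (rule tendsto_Lim[OF _ class_A_log_derivative_tendsto_1[OF f]]) simp
  then show ?thesis
    using starlike_univalent_if_starlike_condition[OF f star] star by (auto simp: quot0_def)
qed

end
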